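(* Let $|\psi\rangle_{AB}=\sum_{j,k\in\{0,1\}}c_{jk}|jk\rangle_{AB}$ be a pure state (unit vector) of the two-qubit system $AB$, i.e. in $\mathbb{C}^2\otimes\mathbb{C}^2$. When it does not satisfy the diagonal condition, that is, when $c_{00}^*c_{01}+c_{10}^*c_{11}\neq 0$, its Schmidt decomposition is expressed as $$|\psi\rangle_{AB}=\sum_{j=0}^1\lambda_j\left(\frac{|x_j\rangle_A}{\||x_j\rangle\|}\right)\otimes\left(\frac{|y_j^*\rangle_B}{\||y_j\rangle\|}\right),$$ where the Schmidt coefficients $\lambda_j$ are $$\lambda_j=\left(\frac{1+(-1)^j\sqrt{1-C(|\psi\rangle)^2}}{2}\right)^{1/2},\qquad C(|\psi\rangle)=2|c_{00}c_{11}-c_{01}c_{10}|,$$ and the unnormalized vectors $|y_j\rangle$ and $|x_j\rangle$ are $$|y_j\rangle=\begin{bmatrix}c_{00}^*c_{01}+c_{10}^*c_{11}\\ \lambda_j^2-|c_{00}|^2-|c_{10}|^2\end{bmatrix},\qquad |x_j\rangle=\begin{bmatrix}c_{00}&c_{01}\\c_{10}&c_{11}\end{bmatrix}|y_j\rangle .$$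
   Context: $|0\rangle,|1\rangle$ is the standard basis of $\mathbb{C}^2$, $|jk\rangle_{AB}=|j\rangle_A\otimes|k\rangle_B$, column vectors are with respect to the standard basis, $^*$ on scalars is complex conjugation, and $|y^*\rangle$ is the entrywise complex conjugate of $|y\rangle$. $C(|\psi\rangle)$ is the concurrence of $|\psi\rangle$. A Schmidt decomposition of a unit vector $|\psi\rangle\in\mathbb{C}^2\otimes\mathbb{C}^2$ is an expression $|\psi\rangle=\sum_j\lambda_j|u_j\rangle\otimes|v_j\rangle$ with $\lambda_j\ge 0$ (the Schmidt coefficients) and with $\{|u_j\rangle\}$, $\{|v_j\rangle\}$ orthonormal families in $\mathbb{C}^2$. *)

theory Defs
  imports "HOL-Analysis.Analysis"
begin

text \<open>
  The space of one qubit is \<^typ>\<open>complex^2\<close> and that of two qubits is \<^typ>\<open>complex^(2 \<times> 2)\<close>.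
  The kets are labelled by the elements \<open>0, 1\<close> of the type \<open>2\<close>. In this type \<open>0 = 2\<close>, so
  that \<open>vector [a, b]\<close>, whose entries are numbered \<open>1, 2\<close>, would have \<open>b\<close> at index \<open>0\<close>;
  columns are therefore written with \<open>col2\<close>.
\<close>

definition col2 :: "complex \<Rightarrow> complex \<Rightarrow> complex^2" where
  "col2 a b = (\<chi> i. if i = 0 then a else b)"

definition ket :: "2 \<Rightarrow> complex^2" where
  "ket j = axis j 1"

definition tensor :: "complex^2 \<Rightarrow> complex^2 \<Rightarrow> complex^(2 \<times> 2)" (infixr "\<otimes>\<^sub>v" 75) where
  "u \<otimes>\<^sub>v v = (\<chi> p. u $ fst p * v $ snd p)"

definition kronecker :: "complex^2^2 \<Rightarrow> complex^2^2 \<Rightarrow> complex^(2 \<times> 2)^(2 \<times> 2)" (infixr "\<otimes>\<^sub>m" 75) where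
  "A \<otimes>\<^sub>m B = (\<chi> p q. A $ fst p $ fst q * B $ snd p $ snd q)"

definition conj_vec :: "complex^'n \<Rightarrow> complex^'n" where
  "conj_vec v = (\<chi> i. cnj (v $ i))"

text \<open>The library's \<open>\<bullet>\<close> on \<^typ>\<open>complex^'n\<close> is only the real part of the Hermitian inner product.\<close>

definition cinner :: "complex^'n \<Rightarrow> complex^'n \<Rightarrow> complex" where
  "cinner u v = (\<Sum>i\<in>UNIV. cnj (u $ i) * v $ i)"

definition orthonormal_family :: "'i set \<Rightarrow> ('i \<Rightarrow> complex^'n) \<Rightarrow> bool" where
  "orthonormal_family J u \<longleftrightarrow> (\<forall>i\<in>J. \<forall>j\<in>J. cinner (u i) (u j) = (if i = j then 1 else 0))"

definition schmidt_decomposition ::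
    "'i set \<Rightarrow> ('i \<Rightarrow> real) \<Rightarrow> ('i \<Rightarrow> complex^2) \<Rightarrow> ('i \<Rightarrow> complex^2) \<Rightarrow> complex^(2 \<times> 2) \<Rightarrow> bool" where
  "schmidt_decomposition J lam u v \<psi> \<longleftrightarrow>
     finite J \<and> (\<forall>j\<in>J. 0 \<le> lam j) \<and> orthonormal_family J u \<and> orthonormal_family J v \<and>
     \<psi> = (\<Sum>j\<in>J. lam j *\<^sub>R (u j \<otimes>\<^sub>v v j))"

definition sigma_y :: "complex^2^2" where
  "sigma_y = (\<chi> j. if j = 0 then col2 0 (- \<i>) else col2 \<i> 0)"

text \<open>Wootters' concurrence of a pure state: the overlap of the state with its spin flip.\<close>

definition concurrence :: "complex^(2 \<times> 2) \<Rightarrow> real" where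
  "concurrence \<psi> = cmod (cinner \<psi> ((sigma_y \<otimes>\<^sub>m sigma_y) *v conj_vec \<psi>))"

end

theory Submission
  imports Defs
begin

text \<open>
  Write \<open>G = c\<^sup>\<dagger> c\<close>. Its trace is \<open>1\<close> and its determinant is \<open>\<bar>det c\<bar>\<^sup>2 = C\<^sup>2 / 4\<close>, so its eigenvalues
  are \<open>\<lambda>\<^sub>0\<^sup>2\<close> and \<open>\<lambda>\<^sub>1\<^sup>2\<close>, and \<open>y\<^sub>j\<close> is an eigenvector for \<open>\<lambda>\<^sub>j\<^sup>2\<close>, non-zero because \<open>G\<close> is not diagonal.
  The normalized \<open>y\<^sub>j\<close> form an orthonormal basis, hence
  \<open>c = \<Sum>\<^sub>j (c y\<^sub>j) y\<^sub>j\<^sup>\<dagger> / \<parallel>y\<^sub>j\<parallel>\<^sup>2\<close>, while \<open>\<langle>c y\<^sub>j, c y\<^sub>k\<rangle> = \<langle>y\<^sub>j, G y\<^sub>k\<rangle>\<close> gives \<open>\<parallel>c y\<^sub>j\<parallel> = \<lambda>\<^sub>j \<parallel>y\<^sub>j\<parallel>\<close>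
  and the orthogonality of the \<open>c y\<^sub>j\<close>.
\<close>

lemma sum_UNIV_2: "sum f (UNIV :: 2 set) = f 0 + (f 1 :: 'a :: comm_monoid_add)"
proof -
  have "(2 :: 2) = 0" by simp
  then show ?thesis by (metis sum_2 add.commute)
qed

lemma all_2_iff: "(\<forall>i :: 2. P i) \<longleftrightarrow> P 0 \<and> P 1"
proof -
  have "(2 :: 2) = 0" by simp
  then show ?thesis by (metis exhaust_2)
qed

lemma vec2_eq_iff: "u = v \<longleftrightarrow> u $ 0 = v $ 0 \<and> u $ 1 = (v :: 'a ^ 2) $ 1"
  by (simp add: vec_eq_iff all_2_iff)

lemma sum_UNIV_2_times_2:
  "sum f (UNIV :: (2 \<times> 2) set) = f (0,0) + f (0,1) + (f (1,0) + (f (1,1) :: 'a :: comm_monoid_add))"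
proof -
  have "sum f (UNIV \<times> UNIV) = (\<Sum>j\<in>UNIV. \<Sum>k\<in>UNIV. f (j :: 2, k :: 2))"
    by (simp add: sum.cartesian_product)
  then show ?thesis by (simp add: sum_UNIV_2)
qed

lemma norm_power2_complex_vec: "(norm (v :: complex ^ 'n))\<^sup>2 = (\<Sum>i\<in>UNIV. (cmod (v $ i))\<^sup>2)"
  by (simp add: norm_vec_def L2_set_def sum_nonneg)

lemma cinner_self: "cinner v v = of_real ((norm v)\<^sup>2)"
  unfolding cinner_def norm_power2_complex_vec of_real_sum
  by (intro sum.cong refl) (metis complex_norm_square mult.commute of_real_power)

lemma cinner_commute: "cinner u v = cnj (cinner v u)"
  by (simp add: cinner_def mult.commute)

lemma cinner_scaleR_scaleR: "cinner (a *\<^sub>R u) (b *\<^sub>R v) = of_real (a * b) * cinner u v"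
  by (simp add: cinner_def sum_distrib_left scaleR_conv_of_real[where 'a = complex] mult_ac)

lemma cinner_mult_right: "cinner u (a *s v) = a * cinner u v"
  by (simp add: cinner_def sum_distrib_left mult_ac)

lemma cinner_conj_vec: "cinner (conj_vec u) (conj_vec v) = cinner v u"
  by (simp add: cinner_def conj_vec_def mult.commute)

lemma norm_conj_vec: "norm (conj_vec v) = norm v"
  by (simp add: norm_vec_def conj_vec_def)

text \<open>The matrix \<open>G\<close> of the overview.\<close>

definition gram :: "complex^'n^'m \<Rightarrow> complex^'n^'n" where
  "gram c = (\<chi> i j. \<Sum>k\<in>UNIV. cnj (c $ k $ i) * c $ k $ j)"

lemma cinner_matrix_vector_mult:
  fixes c :: "complex^2^2"
  shows "cinner (c *v u) (c *v v) = cinner u (gram c *v v)"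
  by (simp add: cinner_def gram_def matrix_vector_mult_def sum_UNIV_2 algebra_simps)

lemma orthonormal_family_pair:
  fixes u :: "nat \<Rightarrow> complex^'n"
  assumes "norm (u 0) = 1" "norm (u 1) = 1" "cinner (u 0) (u 1) = 0"
  shows "orthonormal_family {0, 1} u"
  using assms cinner_commute[of "u 1" "u 0"] by (simp add: orthonormal_family_def cinner_self)

text \<open>The spin flip conjugates the coefficients and reverses their order with signs -, +, +,
  -, so the overlap is -2 times the conjugate of the coefficient determinant.\<close>

lemma concurrence_explicit:
  "concurrence \<psi> = 2 * cmod (\<psi> $ (0,0) * \<psi> $ (1,1) - \<psi> $ (0,1) * \<psi> $ (1,0))"
proof -
  have "cinner \<psi> ((sigma_y \<otimes>\<^sub>m sigma_y) *v conj_vec \<psi>)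
      = cnj (- 2 * (\<psi> $ (0,0) * \<psi> $ (1,1) - \<psi> $ (0,1) * \<psi> $ (1,0)))"
    by (simp add: cinner_def matrix_vector_mult_def sum_UNIV_2_times_2 kronecker_def sigma_y_def
        col2_def conj_vec_def algebra_simps)
  then show ?thesis
    by (simp only: concurrence_def complex_mod_cnj norm_mult) simp
qed

lemma product_basis_expansion_nth:
  "(\<Sum>j\<in>UNIV. \<Sum>k\<in>UNIV. c $ j $ k *s (ket j \<otimes>\<^sub>v ket k)) $ (a, b) = c $ a $ b"
proof -
  have "\<forall>a b. (\<Sum>j\<in>UNIV. \<Sum>k\<in>UNIV. c $ j $ k *s (ket j \<otimes>\<^sub>v ket k)) $ (a, b) = c $ a $ b"
    unfolding all_2_iff by (simp add: sum_UNIV_2 tensor_def ket_def axis_def)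
  then show ?thesis by blast
qed

text \<open>Multiplicativity of the determinant for \<open>G\<close>, in entries. Over the complex
  numbers each squared modulus becomes a product, which leaves a polynomial identity.\<close>

lemma det_gram_2:
  fixes c :: "complex^2^2"
  shows "((cmod (c$0$0))\<^sup>2 + (cmod (c$1$0))\<^sup>2) * ((cmod (c$0$1))\<^sup>2 + (cmod (c$1$1))\<^sup>2)
     - (cmod (cnj (c$0$0) * c$0$1 + cnj (c$1$0) * c$1$1))\<^sup>2
   = (cmod (c$0$0 * c$1$1 - c$0$1 * c$1$0))\<^sup>2"
proof -
  have "complex_of_real (((cmod (c$0$0))\<^sup>2 + (cmod (c$1$0))\<^sup>2) * ((cmod (c$0$1))\<^sup>2 + (cmod (c$1$1))\<^sup>2)
     - (cmod (cnj (c$0$0) * c$0$1 + cnj (c$1$0) * c$1$1))\<^sup>2)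
   = complex_of_real ((cmod (c$0$0 * c$1$1 - c$0$1 * c$1$0))\<^sup>2)"
    by (simp only: of_real_diff of_real_mult of_real_add complex_norm_square)
      (simp add: algebra_simps)
  then show ?thesis by (simp only: of_real_eq_iff)
qed

text \<open>For a product state \<open>lam 1 = 0\<close> and \<open>x 1 = 0\<close>, so the
  normalized \<open>x 1\<close> is \<open>0\<close> and not a unit vector. The displayed sum
  survives, but orthonormality needs a family \<open>u\<close> that completes it.\<close>

theorem proposition2:
  fixes c :: "complex^2^2" and \<psi> :: "complex^(2 \<times> 2)"
    and lam :: "nat \<Rightarrow> real" and x y :: "nat \<Rightarrow> complex^2"
  assumes psi: "\<psi> = (\<Sum>j\<in>UNIV. \<Sum>k\<in>UNIV. c $ j $ k *s (ket j \<otimes>\<^sub>v ket k))"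
    and unit: "norm \<psi> = 1"
    and not_diagonal: "cnj (c$0$0) * c$0$1 + cnj (c$1$0) * c$1$1 \<noteq> 0"
    and lam: "\<And>j. lam j = sqrt ((1 + (- 1) ^ j * sqrt (1 - (concurrence \<psi>)\<^sup>2)) / 2)"
    and y: "\<And>j. y j = col2 (cnj (c$0$0) * c$0$1 + cnj (c$1$0) * c$1$1)
                            (of_real ((lam j)\<^sup>2 - (cmod (c$0$0))\<^sup>2 - (cmod (c$1$0))\<^sup>2))"
    and x: "\<And>j. x j = c *v y j"
  shows "concurrence \<psi> = 2 * cmod (c$0$0 * c$1$1 - c$0$1 * c$1$0)
    \<and> (\<forall>j\<in>{0, 1}. y j \<noteq> 0 \<and> (x j = 0 \<longleftrightarrow> lam j = 0))
    \<and> \<psi> = (\<Sum>j\<in>{0, 1}. lam j *\<^sub>R ((x j /\<^sub>R norm (x j)) \<otimes>\<^sub>v (conj_vec (y j) /\<^sub>R norm (y j))))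
    \<and> (\<exists>u. (\<forall>j\<in>{0, 1}. x j \<noteq> 0 \<longrightarrow> u j = x j /\<^sub>R norm (x j))
          \<and> schmidt_decomposition {0, 1} lam u (\<lambda>j. conj_vec (y j) /\<^sub>R norm (y j)) \<psi>)"
proof -
  \<comment> \<open>Keeps the index \<open>1\<close> from turning into \<open>Suc 0\<close>, so that
    facts about \<open>lam 1\<close> or \<open>y 1\<close> still match.\<close>
  note One_nat_def [simp del]
  define b where "b = cnj (c$0$0) * c$0$1 + cnj (c$1$0) * c$1$1"
  define p where "p = (cmod (c$0$0))\<^sup>2 + (cmod (c$1$0))\<^sup>2"
  define q where "q = (cmod (c$0$1))\<^sup>2 + (cmod (c$1$1))\<^sup>2"
  define s where "s j = (lam j)\<^sup>2 - p" for j
  have b0: "b \<noteq> 0" using not_diagonal by (simp add: b_def)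
  have psi_nth: "\<psi> $ (a, k) = c $ a $ k" for a k
    unfolding psi by (rule product_basis_expansion_nth)
  have conc: "concurrence \<psi> = 2 * cmod (c$0$0 * c$1$1 - c$0$1 * c$1$0)"
    by (simp add: concurrence_explicit psi_nth)
  have trace: "p + q = 1"
    using unit norm_power2_complex_vec[of \<psi>]
    by (simp add: sum_UNIV_2_times_2 psi_nth p_def q_def algebra_simps)
  have det: "4 * (p * q - (cmod b)\<^sup>2) = (concurrence \<psi>)\<^sup>2"
    using det_gram_2[of c] by (simp add: conc p_def q_def b_def power_mult_distrib)
  define r where "r = sqrt (1 - (concurrence \<psi>)\<^sup>2)"
  \<comment> \<open>The discriminant of the characteristic polynomial of \<open>G\<close>; being a
    sum of squares, it makes the square root \<open>r\<close> genuine.\<close>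
  have disc: "1 - (concurrence \<psi>)\<^sup>2 = (p - q)\<^sup>2 + 4 * (cmod b)\<^sup>2"
  proof -
    have "1 - (concurrence \<psi>)\<^sup>2 = (p + q)\<^sup>2 - 4 * (p * q - (cmod b)\<^sup>2)"
      using trace det by simp
    then show ?thesis by (simp add: power2_eq_square algebra_simps)
  qed
  then have r_sq: "r\<^sup>2 = 1 - (concurrence \<psi>)\<^sup>2" and r_nonneg: "0 \<le> r"
    by (simp_all add: r_def)
  have r_le: "r \<le> 1"
    by (simp add: r_def)
  have lam_r: "lam 0 = sqrt ((1 + r) / 2)" "lam 1 = sqrt ((1 - r) / 2)"
    by (simp_all add: lam r_def)
  have lam_nonneg: "0 \<le> lam 0" "0 \<le> lam 1" and lam0_pos: "0 < lam 0"
    using r_nonneg r_le by (simp_all add: lam_r)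
  have lam_sq: "(lam 0)\<^sup>2 = (1 + r) / 2" "(lam 1)\<^sup>2 = (1 - r) / 2"
    using r_nonneg r_le by (simp_all add: lam_r)
  \<comment> \<open>The characteristic equation of \<open>G\<close> at
    \<open>(lam j)\<^sup>2 = s j + p\<close>, obtained by completing the square.\<close>
  have s_root: "s j * (s j + p - q) = (cmod b)\<^sup>2" if "j \<in> {0, 1}" for j
  proof -
    have "2 * s j + p - q = 2 * (lam j)\<^sup>2 - 1"
      using trace by (simp add: s_def)
    also have "\<dots> = r \<or> \<dots> = - r"
      using that lam_sq by auto
    finally have "(2 * s j + p - q)\<^sup>2 = (p - q)\<^sup>2 + 4 * (cmod b)\<^sup>2"
      using r_sq disc by (metis power2_minus)
    then show ?thesis by (simp add: power2_eq_square algebra_simps)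
  qed
  \<comment> \<open>Vieta for the two roots \<open>s 0\<close>, \<open>s 1\<close>. Their product
    yields both \<open>s_nz\<close> and the orthogonality of \<open>y 0\<close> and
    \<open>y 1\<close>.\<close>
  have s_sum: "s 1 = q - p - s 0"
    using trace lam_sq by (simp add: s_def field_simps)
  have s_prod: "s 0 * s 1 = - (cmod b)\<^sup>2"
    using s_root[of 0] by (simp add: s_sum algebra_simps)
  have s_nz: "s 0 \<noteq> 0" "s 1 \<noteq> 0" using s_prod b0 by auto
  have y_nth: "y j $ 0 = b" "y j $ 1 = of_real (s j)" for j
    by (simp_all add: y col2_def b_def s_def p_def)
  have y_norm: "(norm (y j))\<^sup>2 = (cmod b)\<^sup>2 + (s j)\<^sup>2" for j
    by (simp add: norm_power2_complex_vec sum_UNIV_2 y_nth)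
  have y_nz: "y j \<noteq> 0" for j
    using b0 y_nth(1)[of j] by auto
  have y_orth: "cinner (y 0) (y 1) = 0"
  proof -
    have "cinner (y 0) (y 1) = of_real ((cmod b)\<^sup>2 + s 0 * s 1)"
      by (simp add: cinner_def sum_UNIV_2 y_nth mult.commute flip: complex_norm_square)
    then show ?thesis by (simp add: s_prod)
  qed
  have gram_nth: "gram c $ 0 $ 0 = of_real p" "gram c $ 0 $ 1 = b"
    "gram c $ 1 $ 0 = cnj b" "gram c $ 1 $ 1 = of_real q"
    by (simp_all add: gram_def sum_UNIV_2 p_def q_def b_def mult.commute complex_norm_square del: of_real_power)
  \<comment> \<open>The first row is the definition of \<open>s j\<close>, the second is
    \<open>s_root\<close>.\<close>
  have eigen: "gram c *v y j = of_real ((lam j)\<^sup>2) *s y j" if "j \<in> {0, 1}" for j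
  proof -
    have "of_real ((cmod b)\<^sup>2) + of_real q * complex_of_real (s j)
        = of_real ((lam j)\<^sup>2) * of_real (s j)"
    proof -
      have "(cmod b)\<^sup>2 + q * s j = (lam j)\<^sup>2 * s j"
        using s_root[OF that] by (simp add: s_def algebra_simps)
      then show ?thesis by (metis of_real_add of_real_mult)
    qed
    moreover have "of_real p * b + b * of_real (s j) = of_real ((lam j)\<^sup>2) * b"
      by (simp add: s_def algebra_simps)
    ultimately show ?thesis
      by (simp add: vec2_eq_iff matrix_vector_mult_def sum_UNIV_2 gram_nth y_nth
          complex_norm_square mult.commute del: of_real_power)
  qed
  have x_inner: "cinner (x i) (x j) = of_real ((lam j)\<^sup>2) * cinner (y i) (y j)"
    if "j \<in> {0, 1}" for i j
    using eigen[OF that] by (simp add: x cinner_matrix_vector_mult cinner_mult_right)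
  have x_norm: "norm (x j) = lam j * norm (y j)" if "j \<in> {0, 1}" for j
  proof -
    have "(norm (x j))\<^sup>2 = (lam j * norm (y j))\<^sup>2"
      using x_inner[OF that, of j] unfolding cinner_self power_mult_distrib
      by (simp only: flip: of_real_mult) (simp only: of_real_eq_iff)
    moreover have "0 \<le> lam j * norm (y j)"
      using that lam_nonneg by auto
    ultimately show ?thesis by (simp add: power2_eq_iff_nonneg)
  qed
  have x_zero: "x j = 0 \<longleftrightarrow> lam j = 0" if "j \<in> {0, 1}" for j
    using x_norm[OF that] y_nz[of j] by (metis mult_eq_0_iff norm_eq_zero)
  \<comment> \<open>\<open>lam j\<close> cancels against \<open>norm (x j)\<close>; if
    \<open>lam j = 0\<close>, both sides vanish.\<close>
  have summand: "lam j *\<^sub>R ((x j /\<^sub>R norm (x j)) \<otimes>\<^sub>v (conj_vec (y j) /\<^sub>R norm (y j)))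
      = (x j \<otimes>\<^sub>v conj_vec (y j)) /\<^sub>R (norm (y j))\<^sup>2" if "j \<in> {0, 1}" for j
  proof (cases "lam j = 0")
    case True
    then show ?thesis using x_zero[OF that] by (simp add: tensor_def vec_eq_iff)
  next
    case False
    then show ?thesis using x_norm[OF that] y_nz[of j]
      by (simp add: tensor_def vec_eq_iff scaleR_conv_of_real[where 'a = complex] power2_eq_square field_simps)
  qed
  \<comment> \<open>By \<open>s\<^sub>0 s\<^sub>1 = - \<bar>b\<bar>\<^sup>2\<close>, \<open>\<parallel>y\<^sub>j\<parallel>\<^sup>2 = s\<^sub>j (s\<^sub>j - s\<^sub>k)\<close> for \<open>{j, k} = {0, 1}\<close>; this gives the entries of
    \<open>\<Sum>\<^sub>j y\<^sub>j y\<^sub>j\<^sup>\<dagger> / \<parallel>y\<^sub>j\<parallel>\<^sup>2\<close>.\<close>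
  have n: "(norm (y 0))\<^sup>2 = s 0 * (s 0 - s 1)" "(norm (y 1))\<^sup>2 = s 1 * (s 1 - s 0)"
    using s_prod unfolding y_norm by (simp_all add: power2_eq_square algebra_simps)
  have s_neq: "s 0 - s 1 \<noteq> 0"
    using n(1) y_nz[of 0] by auto
  have bb: "(cmod b)\<^sup>2 = - (s 0 * s 1)" using s_prod by simp
  have res: "(cmod b)\<^sup>2 / (norm (y 0))\<^sup>2 + (cmod b)\<^sup>2 / (norm (y 1))\<^sup>2 = 1"
    "s 0 / (norm (y 0))\<^sup>2 + s 1 / (norm (y 1))\<^sup>2 = 0"
    "s 0 * s 0 / (norm (y 0))\<^sup>2 + s 1 * s 1 / (norm (y 1))\<^sup>2 = 1"
    using s_neq s_nz by (simp_all add: n bb divide_simps)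
      (simp_all add: power2_eq_square algebra_simps)
  have decomp: "\<psi> = (\<Sum>j\<in>{0, 1}. (x j \<otimes>\<^sub>v conj_vec (y j)) /\<^sub>R (norm (y j))\<^sup>2)"
  proof -
    have "\<psi> $ (a, k) = (\<Sum>j\<in>{0, 1}. (x j \<otimes>\<^sub>v conj_vec (y j)) /\<^sub>R (norm (y j))\<^sup>2) $ (a, k)" for a k
    proof -
      define m where "m j = complex_of_real ((norm (y j))\<^sup>2)" for j
      have m: "b * cnj b / m 0 + b * cnj b / m 1 = 1" "s 0 / m 0 + s 1 / m 1 = 0"
        "of_real (s 0) * of_real (s 0) / m 0 + of_real (s 1) * of_real (s 1) / m 1 = 1"
        using res[THEN arg_cong[where f = complex_of_real]]
        unfolding m_def complex_norm_square[symmetric] by (simp_all del: of_real_power)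
      have x_nth: "x j $ a = c $ a $ 0 * b + c $ a $ 1 * s j" for j
        by (simp add: x matrix_vector_mult_def sum_UNIV_2 y_nth)
      have "(\<Sum>j\<in>{0, 1}. (x j \<otimes>\<^sub>v conj_vec (y j)) /\<^sub>R (norm (y j))\<^sup>2) $ (a, k)
          = x 0 $ a * cnj (y 0 $ k) / m 0 + x 1 $ a * cnj (y 1 $ k) / m 1"
        by (simp add: tensor_def conj_vec_def scaleR_conv_of_real[where 'a = complex] m_def field_simps)
      also have "\<dots> = c $ a $ k"
      proof -
        \<comment> \<open>Collecting by the entries of row \<open>a\<close> of \<open>c\<close>
          leaves only the sums in \<open>m\<close>.\<close>
        have "x 0 $ a * cnj (y 0 $ 0) / m 0 + x 1 $ a * cnj (y 1 $ 0) / m 1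
            = c $ a $ 0 * (b * cnj b / m 0 + b * cnj b / m 1)
              + c $ a $ 1 * cnj b * (s 0 / m 0 + s 1 / m 1)"
          by (simp add: x_nth y_nth add_divide_distrib algebra_simps)
        moreover have "x 0 $ a * cnj (y 0 $ 1) / m 0 + x 1 $ a * cnj (y 1 $ 1) / m 1
            = c $ a $ 0 * b * (s 0 / m 0 + s 1 / m 1)
              + c $ a $ 1 * (of_real (s 0) * of_real (s 0) / m 0
                + of_real (s 1) * of_real (s 1) / m 1)"
          by (simp add: x_nth y_nth add_divide_distrib algebra_simps)
        ultimately have "\<forall>k. x 0 $ a * cnj (y 0 $ k) / m 0 + x 1 $ a * cnj (y 1 $ k) / m 1 = c $ a $ k"
          unfolding all_2_iff by (simp add: m)
        then show ?thesis by blast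
      qed
      finally show ?thesis by (simp add: psi_nth)
    qed
    then show ?thesis by (simp only: vec_eq_iff[of \<psi>] split_paired_All simp_thms)
  qed
  have psi_eq: "\<psi> = (\<Sum>j\<in>{0, 1}. lam j *\<^sub>R ((x j /\<^sub>R norm (x j)) \<otimes>\<^sub>v (conj_vec (y j) /\<^sub>R norm (y j))))"
    by (rule trans[OF decomp]) (rule sum.cong[OF refl summand[symmetric]])
  \<comment> \<open>Stands in for \<open>x 1\<close> when \<open>lam 1 = 0\<close>, that is, for a product state.\<close>
  define w where "w = col2 (- cnj (x 0 $ 1)) (cnj (x 0 $ 0))"
  have w: "norm w = norm (x 0)" "cinner (x 0) w = 0"
    by (simp_all add: norm_vec_def L2_set_def cinner_def w_def col2_def sum_UNIV_2 add.commute)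
  \<comment> \<open>Since \<open>lam 0 > 0\<close>, \<open>x 0\<close> is non-zero, so on
    \<open>{0, 1}\<close> the vector \<open>w\<close> can enter only at
    \<open>j = 1\<close>.\<close>
  define u where "u j = (if x j \<noteq> 0 then x j else w) /\<^sub>R norm (if x j \<noteq> 0 then x j else w)" for j
  have x0_nz: "x 0 \<noteq> 0" using x_zero[of 0] lam0_pos by simp
  have w_nz: "w \<noteq> 0" using w(1) x0_nz by auto
  have "orthonormal_family {0, 1} u"
    \<comment> \<open>The premise puts \<open>j\<close> before \<open>i\<close> in
      \<open>x_inner\<close>, so \<open>of 1 0\<close> concerns
      \<open>cinner (x 0) (x 1)\<close>.\<close>
    using x0_nz w_nz w(2) x_inner[of 1 0] y_orth
    by (intro orthonormal_family_pair) (simp_all add: u_def cinner_scaleR_scaleR del: of_real_power)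
  moreover have "orthonormal_family {0, 1} (\<lambda>j. conj_vec (y j) /\<^sub>R norm (y j))"
    using y_nz y_orth cinner_commute[of "y 1" "y 0"]
    by (intro orthonormal_family_pair)
      (simp_all add: norm_conj_vec cinner_scaleR_scaleR cinner_conj_vec)
  moreover have "\<psi> = (\<Sum>j\<in>{0, 1}. lam j *\<^sub>R (u j \<otimes>\<^sub>v (conj_vec (y j) /\<^sub>R norm (y j))))"
  proof -
    \<comment> \<open>The two families differ only where \<open>x j = 0\<close>, and there the
      coefficient is zero.\<close>
    have "lam j *\<^sub>R ((x j /\<^sub>R norm (x j)) \<otimes>\<^sub>v (conj_vec (y j) /\<^sub>R norm (y j)))
        = lam j *\<^sub>R (u j \<otimes>\<^sub>v (conj_vec (y j) /\<^sub>R norm (y j)))" if "j \<in> {0, 1}" for j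
      using x_zero[OF that] by (cases "x j = 0") (simp_all add: u_def)
    then show ?thesis by (rule trans[OF psi_eq sum.cong[OF refl]])
  qed
  ultimately have "schmidt_decomposition {0, 1} lam u (\<lambda>j. conj_vec (y j) /\<^sub>R norm (y j)) \<psi>"
    using lam_nonneg by (simp add: schmidt_decomposition_def)
  moreover have "\<forall>j\<in>{0, 1}. x j \<noteq> 0 \<longrightarrow> u j = x j /\<^sub>R norm (x j)"
    by (simp add: u_def)
  ultimately have "\<exists>u. (\<forall>j\<in>{0, 1}. x j \<noteq> 0 \<longrightarrow> u j = x j /\<^sub>R norm (x j))
      \<and> schmidt_decomposition {0, 1} lam u (\<lambda>j. conj_vec (y j) /\<^sub>R norm (y j)) \<psi>"
    by (intro exI[of _ u] conjI)
  with conc y_nz x_zero psi_eq show ?thesis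
    by (intro conjI ballI)
qed

end
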